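(* Let $f:\mathbb{R}^k\to\mathbb{R}^k$ be a smooth flux function, let $U:\mathbb{R}^k\to\mathbb{R}$ be a convex entropy with entropy variables $\frac{\mathrm{d}U}{\mathrm{d}u}$, let $u_l,u_r\in\mathbb{R}^k$, and let $\mathcal{U}\subset\mathbb{R}^k$ be a set of admissible conserved values. Let $f^{\mathrm{MLF}}_{\mathcal{U}}=f^{\mathrm{MLF}}_{\mathcal{U}}(u_l,u_r)$ be the modified Lax-Friedrichs flux with admissible set $\mathcal{U}$, and let $f^{\mathrm{D}}_{\mathcal{U}}=f^{\mathrm{D}}_{\mathcal{U}}(u_l,u_r)$ be the Dafermos flux with the same set $\mathcal{U}$ of admissible conserved values. Then the modified Lax-Friedrichs flux is more dissipative than the Dafermos flux, in the sense that $$\left\langle \frac{\mathrm{d}U}{\mathrm{d}u}(u_r)-\frac{\mathrm{d}U}{\mathrm{d}u}(u_l),\, f^{\mathrm{MLF}}_{\mathcal{U}}\right\rangle \;\le\; \left\langle \frac{\mathrm{d}U}{\mathrm{d}u}(u_r)-\frac{\mathrm{d}U}{\mathrm{d}u}(u_l),\, f^{\mathrm{D}}_{\mathcal{U}}\right\rangle .$$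
   Context: $\langle\cdot,\cdot\rangle$ is the Euclidean inner product on $\mathbb{R}^k$ and $\|\cdot\|$ is the Euclidean norm; for the Jacobian $\frac{\mathrm{d}f}{\mathrm{d}u}$ it is the induced operator norm. $\frac{\mathrm{d}U}{\mathrm{d}u}$ is the gradient of $U$, regarded as a vector in $\mathbb{R}^k$. Radius and center: $\mathrm{rad}(\mathcal{U})=\inf_{y}\sup_{u\in\mathcal{U}}\|y-u\|$, and $u_c$ is a center of $\mathcal{U}$ if $\sup_{u\in\mathcal{U}}\|u_c-u\|=\mathrm{rad}(\mathcal{U})$. Dafermos flux with set of admissible conserved values $\mathcal{U}$: $$f^{\mathrm{D}}_{\mathcal{U}}(u_l,u_r)=f\left(\mathop{\mathrm{arg\,min}}_{u\in\mathcal{U}}\left\langle \frac{\mathrm{d}U}{\mathrm{d}u}(u_r)-\frac{\mathrm{d}U}{\mathrm{d}u}(u_l),\,f(u)\right\rangle\right).$$ Modified Lax-Friedrichs flux with admissible set $\mathcal{U}$: $$f^{\mathrm{MLF}}_{\mathcal{U}}(u_l,u_r)=f(u_c)+\frac{\frac{\mathrm{d}U}{\mathrm{d}u}(u_l)-\frac{\mathrm{d}U}{\mathrm{d}u}(u_r)}{\left\|\frac{\mathrm{d}U}{\mathrm{d}u}(u_l)-\frac{\mathrm{d}U}{\mathrm{d}u}(u_r)\right\|}\,\max_{u\in\mathcal{U}}\left\|\frac{\mathrm{d}f}{\mathrm{d}u}(u)\right\|\,\mathrm{rad}(\mathcal{U}),$$ where $u_c$ is a center of $\mathcal{U}$. Both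 fluxes are understood to be given by these formulas, i.e. the minimizer, the maximum, the center and the quotient appearing in them are taken to exist.
   Formalization: The set of admissible conserved values is assumed bounded (so that its radius is finite) and convex; without convexity the claim fails, e.g. for k=1, f(u)=16u²(1−u)², U=u²/2, u_l=0, u_r=1 and the set {0,1}. *)

theory Defs
  imports "HOL-Analysis.Analysis"
begin

text \<open>A map is of class \<open>C\<^sup>n\<close> iff it is differentiable and each of its directional derivatives,
  as a function of the base point, is of class \<open>C\<^sup>n\<^sup>-\<^sup>1\<close>.\<close>

primrec C_n :: "nat \<Rightarrow> ('a::euclidean_space \<Rightarrow> 'b::euclidean_space) \<Rightarrow> bool" where
  "C_n 0 f \<longleftrightarrow> continuous_on UNIV f"
| "C_n (Suc n) f \<longleftrightarrow>
     (\<forall>x. f differentiable at x) \<and> (\<forall>v. C_n n (\<lambda>x. frechet_derivative f (at x) v))"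

definition smooth :: "('a::euclidean_space \<Rightarrow> 'b::euclidean_space) \<Rightarrow> bool" where
  "smooth f \<longleftrightarrow> (\<forall>n. C_n n f)"

text \<open>Meaningful only at points where the function is differentiable.\<close>

definition gradient :: "('a::euclidean_space \<Rightarrow> real) \<Rightarrow> 'a \<Rightarrow> 'a" where
  "gradient U u = (THE D. GDERIV U u :> D)"

text \<open>The infimum and supremum are those of the reals, so both notions below are meaningful only for
  nonempty bounded sets. A center need not belong to the set.\<close>

definition rad :: "'a::euclidean_space set \<Rightarrow> real" where
  "rad A = (INF y. SUP u\<in>A. norm (y - u))"

definition is_center :: "'a::euclidean_space set \<Rightarrow> 'a \<Rightarrow> bool" where
  "is_center A c \<longleftrightarrow> (SUP u\<in>A. norm (c - u)) = rad A"

text \<open>Minimizers need not be unique, so the fluxes are given as relations: the last argument is a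
  value of the flux for some choice of the minimizer, respectively of the center. They include
  the existence of all ingredients of the defining formulas; in particular
  no value is related to a pair of states with equal entropy variables by \<open>mlf_flux\<close>.\<close>

definition dafermos_flux ::
    "('a::euclidean_space \<Rightarrow> 'a) \<Rightarrow> ('a \<Rightarrow> real) \<Rightarrow> 'a set \<Rightarrow> 'a \<Rightarrow> 'a \<Rightarrow> 'a \<Rightarrow> bool" where
  "dafermos_flux f U A ul ur v \<longleftrightarrow>
     (\<exists>u. is_arg_min (\<lambda>u. inner (gradient U ur - gradient U ul) (f u)) (\<lambda>u. u \<in> A) u \<and> v = f u)"

text \<open>The maximum of the operator norm of the Jacobian is its value at a maximizer \<open>w\<close>.\<close>

definition mlf_flux ::
    "('a::euclidean_space \<Rightarrow> 'a) \<Rightarrow> ('a \<Rightarrow> real) \<Rightarrow> 'a set \<Rightarrow> 'a \<Rightarrow> 'a \<Rightarrow> 'a \<Rightarrow> bool" where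
  "mlf_flux f U A ul ur v \<longleftrightarrow>
     gradient U ul \<noteq> gradient U ur \<and>
     (\<exists>c w. is_center A c \<and>
        is_arg_max (\<lambda>u. onorm (frechet_derivative f (at u))) (\<lambda>u. u \<in> A) w \<and>
        v = f c + (onorm (frechet_derivative f (at w)) * rad A) *\<^sub>R
              ((gradient U ul - gradient U ur) /\<^sub>R norm (gradient U ul - gradient U ur)))"

end

theory Submission
  imports Defs
begin

text \<open>Write \<open>g\<close> for the jump of the entropy variables from left to right and \<open>L\<close> for the maximal
  norm of the Jacobian on \<open>A\<close>. The viscous term of the modified Lax-Friedrichs flux points in the
  direction \<open>- g\<close>, so it contributes exactly \<open>- L * rad A * norm g\<close> to the entropy dissipation.
  The Dafermos flux is \<open>f u\<close> for some \<open>u \<in> A\<close>. By Cauchy-Schwarz, replacing \<open>f u\<close> by \<open>f c\<close>, with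
  \<open>c\<close> the center, raises the pairing with \<open>g\<close> by at most \<open>norm g * norm (f c - f u)\<close>, and
  given \<open>norm (f c - f u) \<le> L * norm (c - u)\<close>, this is at most \<open>norm g * L * rad A\<close>: the viscous
  term makes up for it. It does not matter which point of \<open>A\<close> the minimization selects.

  The Lipschitz estimate needs care, because \<open>L\<close> controls the Jacobian on \<open>A\<close> only, whereas a center
  may lie outside \<open>A\<close>. For convex \<open>A\<close> it still lies in the closure
  (\<open>center_in_closure\<close>), and the mean value inequality extends to the closure by continuity
  (\<open>norm_diff_le_onorm_closure\<close>).\<close>

lemma norm_diff_le_SUP_norm:
  fixes A :: "'a::real_normed_vector set"
  assumes "bounded A" "u \<in> A"
  shows "norm (y - u) \<le> (SUP u\<in>A. norm (y - u))"
proof (rule cSUP_upper[OF \<open>u \<in> A\<close>])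
  have "bounded ((\<lambda>u. y - u) ` A)"
    using bounded_minus_comp[of "\<lambda>_. y" A "\<lambda>u. u"] assms(1) by (auto simp: image_constant_conv)
  then have "bounded ((\<lambda>u. norm (y - u)) ` A)"
    using bounded_norm_comp by fastforce
  then show "bdd_above ((\<lambda>u. norm (y - u)) ` A)"
    by (rule bounded_imp_bdd_above)
qed

lemma rad_le_SUP_norm:
  assumes "bounded A" "A \<noteq> {}"
  shows "rad A \<le> (SUP u\<in>A. norm (y - u))"
  unfolding rad_def
proof (rule cINF_lower)
  obtain a where "a \<in> A" using assms(2) by blast
  then have "0 \<le> (SUP u\<in>A. norm (z - u))" for z
    using norm_diff_le_SUP_norm[OF assms(1), of a z] norm_ge_zero[of "z - a"] by linarith
  then show "bdd_below (range (\<lambda>y. SUP u\<in>A. norm (y - u)))"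
    by (intro bdd_belowI[of _ 0]) auto
qed simp

text \<open>Projecting a point \<open>c\<close> at distance \<open>d > 0\<close> from a convex set onto the closure lowers the
  squared distance to each point of the set by at least \<open>d\<^sup>2\<close>, because the angle at the projection is
  obtuse. This gain is uniform over the set, so the circumscribed radius strictly drops.\<close>

lemma center_in_closure:
  assumes "bounded A" "convex A" "A \<noteq> {}" "is_center A c"
  shows "c \<in> closure A"
proof (rule ccontr)
  assume "c \<notin> closure A"
  define p where "p = closest_point (closure A) c"
  define d where "d = norm (c - p)"
  have cl: "closed (closure A)" "closure A \<noteq> {}" "convex (closure A)"
    using assms by (auto intro: convex_closure)
  have "p \<in> closure A"
    unfolding p_def by (rule closest_point_in_set[OF cl(1,2)])
  with \<open>c \<notin> closure A\<close> have "d > 0"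
    by (auto simp: d_def)
  have le_rad: "norm (c - u) \<le> rad A" if "u \<in> A" for u
    using norm_diff_le_SUP_norm[OF assms(1) that, of c] assms(4) by (simp add: is_center_def)
  have closer: "(norm (p - u))\<^sup>2 \<le> (rad A)\<^sup>2 - d\<^sup>2" if "u \<in> A" for u
  proof -
    have "inner (c - p) (u - p) \<le> 0"
      unfolding p_def using closest_point_dot[OF cl(3,1)] that closure_subset by blast
    moreover have "(norm (c - u))\<^sup>2 = d\<^sup>2 + (norm (p - u))\<^sup>2 - 2 * inner (c - p) (u - p)"
      unfolding d_def power2_norm_eq_inner by (simp add: algebra_simps inner_commute)
    moreover have "(norm (c - u))\<^sup>2 \<le> (rad A)\<^sup>2"
      using le_rad[OF that] by (simp add: power_mono)
    ultimately show ?thesis by linarith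
  qed
  have "rad A \<le> (SUP u\<in>A. norm (p - u))"
    by (rule rad_le_SUP_norm[OF assms(1,3)])
  also have "\<dots> \<le> sqrt ((rad A)\<^sup>2 - d\<^sup>2)"
    by (rule cSUP_least[OF assms(3)]) (use closer real_le_rsqrt in blast)
  also have "\<dots> < sqrt ((rad A)\<^sup>2)"
    using \<open>d > 0\<close> by (intro real_sqrt_less_mono) simp
  also have "\<dots> = rad A"
  proof -
    obtain a where "a \<in> A" using assms(3) by blast
    then have "0 \<le> rad A" using le_rad[of a] norm_ge_zero[of "c - a"] by linarith
    then show ?thesis by simp
  qed
  finally show False by simp
qed

lemma norm_diff_le_onorm_closure:
  fixes f :: "'a::real_normed_vector \<Rightarrow> 'b::real_normed_vector"
  assumes diff: "\<And>x. f differentiable (at x)"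
    and "convex A"
    and bound: "\<And>x. x \<in> A \<Longrightarrow> onorm (frechet_derivative f (at x)) \<le> L"
    and "c \<in> closure A" "u \<in> A"
  shows "norm (f c - f u) \<le> L * norm (c - u)"
proof -
  have der: "(f has_derivative frechet_derivative f (at x)) (at x)" for x
    using diff frechet_derivative_works by blast
  have "norm (f x - f u) \<le> L * norm (x - u)" if "x \<in> A" for x
    by (rule differentiable_bound[OF \<open>convex A\<close> has_derivative_at_withinI[OF der] bound])
      (use that \<open>u \<in> A\<close> in auto)
  then have "A \<subseteq> {x. norm (f x - f u) \<le> L * norm (x - u)}"
    by blast
  moreover have "continuous_on UNIV f"
    using diff by (simp add: continuous_on_eq_continuous_at differentiable_imp_continuous_within)
  then have "closed {x. norm (f x - f u) \<le> L * norm (x - u)}"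
    by (intro closed_Collect_le continuous_intros)
  ultimately show ?thesis
    using \<open>c \<in> closure A\<close> closure_minimal by blast
qed

theorem lemma1:
  fixes f :: "real ^ 'k \<Rightarrow> real ^ 'k"
    and U :: "real ^ 'k \<Rightarrow> real"
    and A :: "(real ^ 'k) set"
    and ul ur fMLF fD :: "real ^ 'k"
  assumes "smooth f"
    and "convex_on UNIV U"
    and "\<And>u. U differentiable (at u)"
    and "bounded A"
    and "convex A"
    and "mlf_flux f U A ul ur fMLF"
    and "dafermos_flux f U A ul ur fD"
  shows "inner (gradient U ur - gradient U ul) fMLF \<le> inner (gradient U ur - gradient U ul) fD"
proof -
  define g where "g = gradient U ur - gradient U ul"
  obtain u where u: "u \<in> A" "fD = f u"
    using assms(7) by (auto simp: dafermos_flux_def is_arg_min_def)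
  obtain c w where "g \<noteq> 0" and c: "is_center A c"
    and w: "is_arg_max (\<lambda>u. onorm (frechet_derivative f (at u))) (\<lambda>u. u \<in> A) w"
    and fMLF: "fMLF = f c + (onorm (frechet_derivative f (at w)) * rad A) *\<^sub>R (- g /\<^sub>R norm g)"
    using assms(6) by (auto simp: mlf_flux_def g_def norm_minus_commute)
  define L where "L = onorm (frechet_derivative f (at w))"
  have diff: "f differentiable (at x)" for x
    using assms(1) C_n.simps(2)[of 0 f] by (auto simp: smooth_def)
  have "bounded_linear (frechet_derivative f (at w))"
    using diff frechet_derivative_works has_derivative_bounded_linear by blast
  then have "L \<ge> 0"
    unfolding L_def by (rule onorm_pos_le)
  have bound: "onorm (frechet_derivative f (at x)) \<le> L" if "x \<in> A" for x
    using w that by (auto simp: is_arg_max_def L_def not_less)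
  have "c \<in> closure A"
    using center_in_closure assms(4,5) u(1) c by blast
  then have "norm (f c - f u) \<le> L * norm (c - u)"
    using norm_diff_le_onorm_closure[OF diff assms(5) bound] u(1) by blast
  also have "\<dots> \<le> L * rad A"
    using norm_diff_le_SUP_norm[OF assms(4) u(1), of c] c \<open>L \<ge> 0\<close>
    by (simp add: is_center_def mult_left_mono)
  finally have "norm g * norm (f c - f u) \<le> norm g * (L * rad A)"
    by (simp add: mult_left_mono)
  then have "inner g (f c - f u) \<le> norm g * (L * rad A)"
    using norm_cauchy_schwarz[of g "f c - f u"] by linarith
  moreover have "inner g fMLF = inner g (f c) - norm g * (L * rad A)"
  proof -
    have "inner g (- g /\<^sub>R norm g) = - norm g"
      using \<open>g \<noteq> 0\<close> by (simp add: power2_norm_eq_inner[symmetric] power2_eq_square)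
    then show ?thesis
      unfolding fMLF L_def[symmetric] inner_add_right inner_scaleR_right[of g "L * rad A"]
      by simp
  qed
  ultimately show ?thesis
    unfolding g_def[symmetric] u(2) by (simp add: inner_diff_right)
qed

end
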